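(* Let $\mathcal{B}$ be a unital C*-algebra and let $\mathcal{M}$ be a unital commutative C*-subalgebra of $\mathcal{B}$. The following are equivalent: (1) $\mathcal{M}$ is normal in $\mathcal{B}$, i.e. $\mathcal{M}=(\mathcal{M},\mathcal{B})''$. (2) $\mathcal{M}$ is an intersection of masas in $\mathcal{B}$. (3) $\mathcal{M}$ is an intersection of algebras of the form $(\mathcal{S},\mathcal{B})'$ for subsets $\mathcal{S}$ of $\mathcal{B}$.
   Context: A unital C*-subalgebra of $\mathcal{B}$ contains the identity of $\mathcal{B}$. A masa in $\mathcal{B}$ is a maximal abelian selfadjoint subalgebra of $\mathcal{B}$. For a subset $\mathcal{S}\subseteq\mathcal{B}$, the relative commutant is $(\mathcal{S},\mathcal{B})'=\{T\in\mathcal{B}: TS=ST \text{ for all } S\in\mathcal{S}\}$ and the relative double commutant is $(\mathcal{S},\mathcal{B})''=\{T\in\mathcal{B}: TA=AT \text{ for all } A\in(\mathcal{S},\mathcal{B})'\}$. *)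

theory Defs
  imports "HOL-Analysis.Analysis"
begin

text \<open>
  A unital C*-algebra is rendered as a type class: the ambient algebra is the whole type.
  The superclasses provide the Banach space structure, a submultiplicative norm and the unit; the
  class adds complex scalars (extending the real ones) and the involution. The class
  \<open>real_normed_algebra_1\<close> is not used, since it would exclude the zero algebra; when
  \<open>1 \<noteq> 0\<close>, the equation \<open>norm 1 = 1\<close> follows from the C*-identity.
\<close>

class unital_cstar_algebra = banach + real_normed_algebra + monoid_mult +
  fixes scaleC :: "complex \<Rightarrow> 'a \<Rightarrow> 'a"  (infixr "*\<^sub>C" 75)
    and adj :: "'a \<Rightarrow> 'a"
  assumes scaleC_of_real: "of_real r *\<^sub>C x = r *\<^sub>R x"
    and scaleC_add_right: "c *\<^sub>C (x + y) = c *\<^sub>C x + c *\<^sub>C y"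
    and scaleC_add_left: "(c + d) *\<^sub>C x = c *\<^sub>C x + d *\<^sub>C x"
    and scaleC_scaleC: "c *\<^sub>C d *\<^sub>C x = (c * d) *\<^sub>C x"
    and mult_scaleC_left: "(c *\<^sub>C x) * y = c *\<^sub>C (x * y)"
    and mult_scaleC_right: "x * (c *\<^sub>C y) = c *\<^sub>C (x * y)"
    and norm_scaleC: "norm (c *\<^sub>C x) = cmod c * norm x"
    and adj_adj: "adj (adj x) = x"
    and adj_add: "adj (x + y) = adj x + adj y"
    and adj_scaleC: "adj (c *\<^sub>C x) = cnj c *\<^sub>C adj x"
    and adj_mult: "adj (x * y) = adj y * adj x"
    and cstar_identity: "norm (adj x * x) = (norm x)\<^sup>2"

definition selfadjoint_subalgebra :: "'b::unital_cstar_algebra set \<Rightarrow> bool" where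
  "selfadjoint_subalgebra A \<longleftrightarrow>
     0 \<in> A \<and>
     (\<forall>x\<in>A. \<forall>y\<in>A. x + y \<in> A) \<and>
     (\<forall>c. \<forall>x\<in>A. c *\<^sub>C x \<in> A) \<and>
     (\<forall>x\<in>A. \<forall>y\<in>A. x * y \<in> A) \<and>
     (\<forall>x\<in>A. adj x \<in> A)"

definition unital_cstar_subalgebra :: "'b::unital_cstar_algebra set \<Rightarrow> bool" where
  "unital_cstar_subalgebra A \<longleftrightarrow> selfadjoint_subalgebra A \<and> closed A \<and> 1 \<in> A"

definition abelian :: "'b::unital_cstar_algebra set \<Rightarrow> bool" where
  "abelian A \<longleftrightarrow> (\<forall>x\<in>A. \<forall>y\<in>A. x * y = y * x)"

text \<open>
  Maximality is among all abelian selfadjoint subalgebras, with no closedness or unitality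
  required; a maximal one has both properties automatically.
\<close>

definition masa :: "'b::unital_cstar_algebra set \<Rightarrow> bool" where
  "masa D \<longleftrightarrow> selfadjoint_subalgebra D \<and> abelian D \<and>
     (\<forall>E. selfadjoint_subalgebra E \<longrightarrow> abelian E \<longrightarrow> D \<subseteq> E \<longrightarrow> E = D)"

definition rel_commutant :: "'b::unital_cstar_algebra set \<Rightarrow> 'b set" where
  "rel_commutant S = {T. \<forall>A\<in>S. T * A = A * T}"

definition rel_double_commutant :: "'b::unital_cstar_algebra set \<Rightarrow> 'b set" where
  "rel_double_commutant S = {T. \<forall>A\<in>rel_commutant S. T * A = A * T}"

definition normal_subalgebra :: "'b::unital_cstar_algebra set \<Rightarrow> bool" where
  "normal_subalgebra M \<longleftrightarrow> M = rel_double_commutant M"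

end

theory Submission
  imports Defs
begin

text \<open>
  The relative double commutant of a commuting selfadjoint set is an abelian selfadjoint subalgebra,
  so by Zorn's lemma such a set lies in a masa. Splitting an element into its selfadjoint parts then
  shows that a masa is its own relative commutant, and that the masas containing an abelian
  selfadjoint subalgebra \<open>M\<close> intersect in the relative double commutant of \<open>M\<close>.
\<close>

lemma rel_double_commutant_eq: "rel_double_commutant S = rel_commutant (rel_commutant S)"
  by (simp add: rel_double_commutant_def rel_commutant_def)

lemma rel_commutant_antimono: "S \<subseteq> T \<Longrightarrow> rel_commutant T \<subseteq> rel_commutant S"
  by (auto simp: rel_commutant_def)

text \<open>Commutation is symmetric, so \<open>rel_commutant\<close> forms an antitone Galois
  connection with itself, and \<open>rel_double_commutant\<close> is the resulting closure
  operator.\<close>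

lemma subset_rel_commutant_iff: "S \<subseteq> rel_commutant T \<longleftrightarrow> T \<subseteq> rel_commutant S"
  unfolding rel_commutant_def by (safe; force)

lemma abelian_iff_subset_rel_commutant: "abelian S \<longleftrightarrow> S \<subseteq> rel_commutant S"
  by (auto simp: abelian_def rel_commutant_def)

lemma subset_rel_double_commutant: "S \<subseteq> rel_double_commutant S"
  unfolding rel_double_commutant_eq using subset_rel_commutant_iff by blast

lemma rel_double_commutant_subset:
  assumes "S \<subseteq> rel_commutant T"
  shows "rel_double_commutant S \<subseteq> rel_commutant T"
  unfolding rel_double_commutant_eq
  by (intro rel_commutant_antimono) (use assms subset_rel_commutant_iff in blast)

text \<open>Closing the left side of \<open>S \<subseteq> rel_commutant S\<close>, swapping sides by
  the Galois connection and closing the left side again puts the double commutant inside its own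
  commutant.\<close>

lemma abelian_rel_double_commutant:
  assumes "abelian S"
  shows "abelian (rel_double_commutant S)"
  unfolding abelian_iff_subset_rel_commutant
  by (meson assms abelian_iff_subset_rel_commutant rel_double_commutant_subset
      subset_rel_commutant_iff)

lemma scaleC_zero_right [simp]: "c *\<^sub>C (0 :: 'a::unital_cstar_algebra) = 0"
  using scaleC_add_right[of c 0 "0::'a"] by simp

lemma scaleC_one [simp]: "1 *\<^sub>C (x :: 'a::unital_cstar_algebra) = x"
  using scaleC_of_real[of 1 x] by simp

lemma scaleC_zero_left [simp]: "0 *\<^sub>C (x :: 'a::unital_cstar_algebra) = 0"
  using scaleC_of_real[of 0 x] by simp

text \<open>Closure under \<open>adj\<close> comes from taking adjoints in
  \<open>x * adj a = adj a * x\<close>, where \<open>adj a\<close> is again in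
  \<open>S\<close>.\<close>

lemma rel_commutant_selfadjoint_subalgebra:
  assumes "\<And>x. x \<in> S \<Longrightarrow> adj x \<in> S"
  shows "selfadjoint_subalgebra (rel_commutant S)"
proof -
  have "adj x \<in> rel_commutant S" if "x \<in> rel_commutant S" for x
  proof -
    have "adj x * a = a * adj x" if "a \<in> S" for a
    proof -
      have "x * adj a = adj a * x"
        using \<open>x \<in> rel_commutant S\<close> assms[OF that] by (simp add: rel_commutant_def)
      then have "adj (x * adj a) = adj (adj a * x)" by simp
      then show ?thesis by (simp add: adj_mult adj_adj)
    qed
    then show ?thesis by (simp add: rel_commutant_def)
  qed
  moreover have "x * y \<in> rel_commutant S"
    if "x \<in> rel_commutant S" "y \<in> rel_commutant S" for x y
    using that by (simp add: rel_commutant_def) (metis mult.assoc)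
  ultimately show ?thesis
    by (auto simp: selfadjoint_subalgebra_def rel_commutant_def distrib_left distrib_right
        mult_scaleC_left mult_scaleC_right)
qed

lemma rel_double_commutant_selfadjoint_subalgebra:
  assumes "\<And>x. x \<in> S \<Longrightarrow> adj x \<in> S"
  shows "selfadjoint_subalgebra (rel_double_commutant S)"
proof -
  have "selfadjoint_subalgebra (rel_commutant S)"
    using assms by (rule rel_commutant_selfadjoint_subalgebra)
  then show ?thesis
    unfolding rel_double_commutant_eq
    by (intro rel_commutant_selfadjoint_subalgebra) (simp add: selfadjoint_subalgebra_def)
qed

lemma chain_Union_abelian_selfadjoint_subalgebra:
  assumes "subset.chain {E. selfadjoint_subalgebra E \<and> abelian E} C" and "C \<noteq> {}"
  shows "selfadjoint_subalgebra (\<Union>C) \<and> abelian (\<Union>C)"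
proof -
  have alg: "selfadjoint_subalgebra E" "abelian E" if "E \<in> C" for E
    using assms that by (auto simp: subset.chain_def)
  \<comment> \<open>Of two members of a chain one contains the other, so every condition on pairs of
    elements can be checked inside a single member.\<close>
  have common: "\<exists>E\<in>C. x \<in> E \<and> y \<in> E" if "x \<in> \<Union>C" "y \<in> \<Union>C" for x y
    using that assms unfolding subset_chain_def by blast
  have "x + y \<in> \<Union>C \<and> x * y \<in> \<Union>C \<and> x * y = y * x" if "x \<in> \<Union>C" "y \<in> \<Union>C" for x y
    using common[OF that] alg unfolding selfadjoint_subalgebra_def abelian_def by blast
  moreover have "c *\<^sub>C x \<in> \<Union>C \<and> adj x \<in> \<Union>C" if "x \<in> \<Union>C" for c x
    using that alg unfolding selfadjoint_subalgebra_def by blast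
  moreover have "0 \<in> \<Union>C"
    using alg \<open>C \<noteq> {}\<close> unfolding selfadjoint_subalgebra_def by blast
  ultimately show ?thesis
    unfolding selfadjoint_subalgebra_def abelian_def by blast
qed

lemma masa_extends:
  assumes "\<And>x. x \<in> S \<Longrightarrow> adj x \<in> S" and "abelian S"
  obtains D where "masa D" and "S \<subseteq> D"
proof -
  define \<A> where "\<A> = {E. (selfadjoint_subalgebra E \<and> abelian E) \<and> S \<subseteq> E}"
  \<comment> \<open>The double commutant of \<open>S\<close> is the starting member for Zorn's
    lemma.\<close>
  have "\<A> \<noteq> {}"
    using rel_double_commutant_selfadjoint_subalgebra[OF assms(1)]
      abelian_rel_double_commutant[OF assms(2)] subset_rel_double_commutant[of S]
    unfolding \<A>_def by blast
  moreover have "\<Union>C \<in> \<A>" if "C \<noteq> {}" "subset.chain \<A> C" for C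
  proof -
    have "subset.chain {E. selfadjoint_subalgebra E \<and> abelian E} C"
      using that(2) by (auto simp: subset_chain_def \<A>_def)
    moreover have "S \<subseteq> E" if "E \<in> C" for E
      using that \<open>subset.chain \<A> C\<close> by (auto simp: subset_chain_def \<A>_def)
    then have "S \<subseteq> \<Union>C"
      using \<open>C \<noteq> {}\<close> by blast
    ultimately show ?thesis
      using chain_Union_abelian_selfadjoint_subalgebra \<open>C \<noteq> {}\<close> unfolding \<A>_def by blast
  qed
  ultimately obtain D where "D \<in> \<A>" and "\<forall>E\<in>\<A>. D \<subseteq> E \<longrightarrow> E = D"
    using subset_Zorn_nonempty[of \<A>] by blast
  \<comment> \<open>Maximality within \<open>\<A>\<close> is full maximality, since anything above
    \<open>D\<close> also contains \<open>S\<close>.\<close>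
  then have "masa D" "S \<subseteq> D"
    unfolding masa_def \<A>_def by auto
  then show thesis by (rule that)
qed

text \<open>Selfadjointness of \<open>h\<close> keeps \<open>insert h M\<close> both stable under
  \<open>adj\<close> and commutative; a general element of the commutant need not commute with its
  own adjoint.\<close>

lemma masa_extends_selfadjoint_commuting:
  assumes "selfadjoint_subalgebra M" and "abelian M" and "h \<in> rel_commutant M" and "adj h = h"
  obtains D where "masa D" and "M \<subseteq> D" and "h \<in> D"
proof (rule masa_extends[of "insert h M"])
  show "adj x \<in> insert h M" if "x \<in> insert h M" for x
    using that assms by (auto simp: selfadjoint_subalgebra_def)
  show "abelian (insert h M)"
    using assms by (auto simp: abelian_def rel_commutant_def)
qed (use that in auto)

lemma selfadjoint_subalgebra_decomposition:
  assumes "selfadjoint_subalgebra A" and "x \<in> A"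
  obtains h k where "h \<in> A" "adj h = h" "k \<in> A" "adj k = k"
    and "x = (1/2) *\<^sub>C (h + (-\<i>) *\<^sub>C k)"
proof
  \<comment> \<open>These are twice the real part of \<open>x\<close> and minus twice its imaginary
    part.\<close>
  let ?h = "x + adj x" and ?k = "\<i> *\<^sub>C x + (-\<i>) *\<^sub>C adj x"
  show "?h \<in> A" "?k \<in> A"
    using assms by (simp_all add: selfadjoint_subalgebra_def)
  show "adj ?h = ?h" "adj ?k = ?k"
    by (simp_all add: adj_add adj_adj adj_scaleC add.commute)
  \<comment> \<open>The explicit coefficients 1 and -1 let \<open>scaleC_add_left\<close>, read
    backwards, collect terms and cancel \<open>adj x\<close>.\<close>
  have "?h + (-\<i>) *\<^sub>C ?k = (1 *\<^sub>C x + 1 *\<^sub>C x) + (1 *\<^sub>C adj x + (-1) *\<^sub>C adj x)"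
    by (simp add: scaleC_add_right scaleC_scaleC ac_simps)
  also have "\<dots> = 2 *\<^sub>C x"
    by (simp only: scaleC_add_left[symmetric]) simp
  finally show "x = (1/2) *\<^sub>C (?h + (-\<i>) *\<^sub>C ?k)"
    by (simp add: scaleC_scaleC)
qed

lemma selfadjoint_subalgebra_subsetI:
  assumes "selfadjoint_subalgebra A" and "selfadjoint_subalgebra B"
    and "\<And>h. h \<in> A \<Longrightarrow> adj h = h \<Longrightarrow> h \<in> B"
  shows "A \<subseteq> B"
proof
  fix x assume "x \<in> A"
  then obtain h k where "h \<in> B" "k \<in> B" "x = (1/2) *\<^sub>C (h + (-\<i>) *\<^sub>C k)"
    using assms selfadjoint_subalgebra_decomposition[of A x] by metis
  then show "x \<in> B"
    using assms(2) by (simp add: selfadjoint_subalgebra_def)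
qed

text \<open>A selfadjoint \<open>h\<close> commuting with \<open>D\<close> lies with
  \<open>D\<close> in some masa, which equals \<open>D\<close> by maximality; selfadjoint elements
  then determine the inclusion.\<close>

lemma masa_eq_rel_commutant:
  assumes "masa D"
  shows "rel_commutant D = D"
proof
  have D: "selfadjoint_subalgebra D" "abelian D"
    using assms by (auto simp: masa_def)
  show "D \<subseteq> rel_commutant D"
    using D by (simp add: abelian_iff_subset_rel_commutant)
  show "rel_commutant D \<subseteq> D"
  proof (rule selfadjoint_subalgebra_subsetI)
    show "selfadjoint_subalgebra (rel_commutant D)"
      using D by (intro rel_commutant_selfadjoint_subalgebra) (simp add: selfadjoint_subalgebra_def)
    show "h \<in> D" if h: "h \<in> rel_commutant D" "adj h = h" for h
    proof -
      obtain E where "masa E" "D \<subseteq> E" "h \<in> E"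
        using masa_extends_selfadjoint_commuting[OF D h] by blast
      then show ?thesis
        using assms unfolding masa_def by blast
    qed
  qed (rule D)
qed

lemma Inter_masas_eq_rel_double_commutant:
  assumes "selfadjoint_subalgebra M" and "abelian M"
  shows "\<Inter>{D. masa D \<and> M \<subseteq> D} = rel_double_commutant M"
proof
  show "rel_double_commutant M \<subseteq> \<Inter>{D. masa D \<and> M \<subseteq> D}"
    using rel_double_commutant_subset masa_eq_rel_commutant by blast
  have adj: "adj x \<in> M" if "x \<in> M" for x
    using that assms(1) by (simp add: selfadjoint_subalgebra_def)
  show "\<Inter>{D. masa D \<and> M \<subseteq> D} \<subseteq> rel_double_commutant M"
  proof
    fix t assume t: "t \<in> \<Inter>{D. masa D \<and> M \<subseteq> D}"
    \<comment> \<open>Some masa contains both \<open>M\<close> and \<open>h\<close>; it also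
      contains \<open>t\<close>, and it is abelian.\<close>
    have comm: "t * h = h * t" if h: "h \<in> rel_commutant M" "adj h = h" for h
    proof -
      obtain D where "masa D" "M \<subseteq> D" "h \<in> D"
        using masa_extends_selfadjoint_commuting[OF assms h] by blast
      then show ?thesis
        using t unfolding masa_def abelian_def by blast
    qed
    have "t * a = a * t" if a: "a \<in> rel_commutant M" for a
    proof -
      obtain h k where "t * h = h * t" "t * k = k * t" "a = (1/2) *\<^sub>C (h + (-\<i>) *\<^sub>C k)"
        using selfadjoint_subalgebra_decomposition
          [OF rel_commutant_selfadjoint_subalgebra[OF adj] a] comm by metis
      then show ?thesis
        by (simp add: mult_scaleC_left mult_scaleC_right distrib_left distrib_right)
    qed
    then show "t \<in> rel_double_commutant M"
      by (simp add: rel_double_commutant_def)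
  qed
qed

text \<open>Commutants are closed sets of the Galois connection, and closed sets are stable under
  intersection.\<close>

lemma normal_subalgebra_Inter_rel_commutants:
  assumes "\<forall>C\<in>\<C>. \<exists>S. C = rel_commutant S"
  shows "normal_subalgebra (\<Inter>\<C>)"
proof -
  have "rel_double_commutant (\<Inter>\<C>) \<subseteq> C" if "C \<in> \<C>" for C
    using assms that rel_double_commutant_subset by (metis Inter_lower)
  then show ?thesis
    unfolding normal_subalgebra_def using subset_rel_double_commutant by blast
qed

theorem corollary1:
  fixes M :: "'b::unital_cstar_algebra set"
  assumes "unital_cstar_subalgebra M"
    and "abelian M"
  shows "(normal_subalgebra M \<longleftrightarrow>
            (\<exists>\<D>. \<D> \<noteq> {} \<and> (\<forall>D\<in>\<D>. masa D) \<and> M = \<Inter>\<D>)) \<and>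
         (normal_subalgebra M \<longleftrightarrow>
            (\<exists>\<C>. \<C> \<noteq> {} \<and> (\<forall>C\<in>\<C>. \<exists>S. C = rel_commutant S) \<and> M = \<Inter>\<C>))"
    (is "(_ \<longleftrightarrow> ?masas) \<and> (_ \<longleftrightarrow> ?commutants)")
proof -
  have M: "selfadjoint_subalgebra M"
    using assms(1) by (simp add: unital_cstar_subalgebra_def)
  have adj: "adj x \<in> M" if "x \<in> M" for x
    using that M by (simp add: selfadjoint_subalgebra_def)
  have ?masas if "normal_subalgebra M"
  proof (intro exI conjI)
    \<comment> \<open>Nonemptiness is a separate matter because \<open>\<Inter>{}\<close> is
      \<open>UNIV\<close>.\<close>
    show "{D. masa D \<and> M \<subseteq> D} \<noteq> {}"
      using masa_extends[OF adj assms(2)] by blast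
    show "M = \<Inter>{D. masa D \<and> M \<subseteq> D}"
      using Inter_masas_eq_rel_double_commutant[OF M assms(2)] that
      by (simp add: normal_subalgebra_def)
  qed simp
  \<comment> \<open>The same family serves: each masa is the commutant of itself.\<close>
  moreover have ?commutants if ?masas
    using that masa_eq_rel_commutant by metis
  moreover have "normal_subalgebra M" if ?commutants
    using that normal_subalgebra_Inter_rel_commutants by auto
  ultimately show ?thesis by blast
qed

end
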